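(* Consider $n$ homogeneous nodes in the SINR capture model with capture ratio $b$, noise power $N_0$, transmission power $P_T$ and i.i.d. Rayleigh fading channels. Suppose that $1<b<\infty$ and that $N_0/P_T$ is sufficiently small. Then, with the same average transmission probability $p$ (equivalently, the same average power investment), the throughput of homogeneous nodes with perfect CSI is not larger than that of homogeneous nodes with no CSI: for every $p\in[0,1]$, $$r^{\mathrm{CSI}}(p)\le r^{\mathrm{no}}(p),$$ where $r^{\mathrm{no}}(p)$ is the average throughput of a node when no CSI is available to the nodes, $r^{\mathrm{CSI}}(p)$ is the average throughput of a node when perfect CSI is available to all nodes (each node using its threshold strategy), and in both cases every node has average transmission probability $p$.
   Context: CSI means channel state information. Setting (one time slot): nodes $1,\dots,n$ may transmit to a base station, each with the same power $P_T>0$. Let $X_i=|h_i|^2$ be the channel power gain of node $i$; $X_1,\dots,X_n$ are i.i.d. exponential random variables with density $e^{-x}$, $x\ge 0$ (Rayleigh fading). Let $B_i\in\{0,1\}$ be the indicator that node $i$ transmits. SINR capture model with capture ratio $b>0$ and noise power $N_0\ge 0$: node $i$'s packet is successfully received if and only if its signal to interference plus noise ratio exceeds $b$, i.e. $$B_iX_iP_T> b\Big(\sum_{j\ne i}B_jX_jP_T+N_0\Big).$$ The average throughput of node $i$ is the probability that its packet is successfully received. No CSI: $B_1,\dots,B_n$ are independent of each other and of $(X_1,\dots,X_n)$, with $\Pr[B_i=1]=p$. Perfect CSI: each node knows its own channel gain and uses the threshold strategy $B_i=1$ if and only if $X_i>T$, where the threshold $T\in[0,\infty]$ satisfies $e^{-T}=p$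 (so the average transmission probability is $p$; $T=\infty$, i.e. never transmitting, if $p=0$). Homogeneous nodes means that all nodes have the same average transmission probability $p$ (and, with perfect CSI, the same threshold $T$), so the average throughput is the same for every node. The regime of sufficiently small $N_0/P_T$ is the interference-limited situation.
   Formalization: Two repairs: n ≥ 2 is assumed (for n = 1 the claim fails whenever N_0 > 0 and 0 < p < 1), and "N_0/P_T sufficiently small" is uniform only over p = 0 and p ≥ p_0 for an arbitrary fixed p_0 > 0, as no bound works for all p near 0. *)

theory Defs
  imports "HOL-Probability.Probability"
begin

text \<open>
  Nodes are numbered \<open>0, \<dots>, n - 1\<close>. \<open>X i\<close> is the channel power gain of node \<open>i\<close>,
  \<open>B i\<close> says whether it transmits, \<open>PT\<close> is the common transmission power and \<open>N0\<close> the noise power.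
  The SINR condition is kept in its product form, since the SINR is undefined when there is
  neither noise nor interference.
\<close>

definition captured ::
  "nat \<Rightarrow> real \<Rightarrow> real \<Rightarrow> real \<Rightarrow> (nat \<Rightarrow> bool) \<Rightarrow> (nat \<Rightarrow> real) \<Rightarrow> nat \<Rightarrow> bool" where
  "captured n b N0 PT B X i \<longleftrightarrow>
     of_bool (B i) * X i * PT > b * ((\<Sum>j\<in>{..<n} - {i}. of_bool (B j) * X j * PT) + N0)"

definition rayleigh_gain :: "real measure" where
  "rayleigh_gain = density lborel (exponential_density 1)"

definition gains :: "nat \<Rightarrow> (nat \<Rightarrow> real) measure" where
  "gains n = Pi\<^sub>M {..<n} (\<lambda>_. rayleigh_gain)"

definition decisions :: "nat \<Rightarrow> real \<Rightarrow> (nat \<Rightarrow> bool) measure" where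
  "decisions n p = Pi\<^sub>M {..<n} (\<lambda>_. measure_pmf (bernoulli_pmf p))"

definition r_no :: "nat \<Rightarrow> real \<Rightarrow> real \<Rightarrow> real \<Rightarrow> real \<Rightarrow> nat \<Rightarrow> real" where
  "r_no n b N0 PT p i =
     \<P>(\<omega> in gains n \<Otimes>\<^sub>M decisions n p. captured n b N0 PT (snd \<omega>) (fst \<omega>) i)"

text \<open>
  \<open>csi_threshold p\<close> is the solution \<open>T \<in> [0, \<infinity>]\<close> of \<open>exp (- T) = p\<close>; see
  \<open>csi_threshold_unique\<close> and \<open>csi_transmission_probability\<close> below.
\<close>

definition csi_threshold :: "real \<Rightarrow> ereal" where
  "csi_threshold p = (if p = 0 then \<infinity> else ereal (- ln p))"

definition r_csi :: "nat \<Rightarrow> real \<Rightarrow> real \<Rightarrow> real \<Rightarrow> real \<Rightarrow> nat \<Rightarrow> real" where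
  "r_csi n b N0 PT p i =
     \<P>(X in gains n. captured n b N0 PT (\<lambda>j. ereal (X j) > csi_threshold p) X i)"

lemma csi_threshold_unique:
  assumes "p \<in> {0..1}"
  shows "0 \<le> T \<and> (if T = \<infinity> then 0 else exp (- real_of_ereal T)) = p \<longleftrightarrow> T = csi_threshold p"
  using assms by (cases T) (auto simp: csi_threshold_def)

lemma prob_space_rayleigh_gain: "prob_space rayleigh_gain"
  unfolding rayleigh_gain_def by (rule prob_space_exponential_density) simp

lemma csi_transmission_probability:
  assumes "p \<in> {0..1}"
  shows "\<P>(x in rayleigh_gain. ereal x > csi_threshold p) = p"
proof (cases "p = 0")
  case True
  then show ?thesis by (simp add: csi_threshold_def)
next
  case False
  with assms have p: "0 < p" "p \<le> 1" by auto
  interpret prob_space rayleigh_gain by (rule prob_space_rayleigh_gain)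
  have "distributed rayleigh_gain lborel (\<lambda>x. x) (\<lambda>x. ennreal (exponential_density 1 x))"
    unfolding distributed_def rayleigh_gain_def
    by (auto intro!: distr_id2 simp: sets_density)
  from exponential_distributedD_gt[OF this, of "- ln p"] p
  have "\<P>(x in rayleigh_gain. - ln p < x) = p" by simp
  with False show ?thesis by (simp add: csi_threshold_def)
qed

end

theory Submission
  imports Defs
begin

text \<open>
  Put \<open>\<nu> = N0 / PT\<close>, \<open>m = n - 1\<close>, \<open>e = exp (- b \<nu>)\<close> and \<open>A = 1 - p\<close>. Integrating out the gain of node \<open>i\<close>
  turns the capture probability into the expectation of \<open>exp (- Y)\<close>, where \<open>Y\<close> is the larger of the
  threshold \<open>T\<close> and \<open>b\<close> times interference plus noise; this factorises over the other nodes. Without CSI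
  it gives \<open>p e (A + v)\<^sup>m\<close> with \<open>v = p / (1 + b)\<close>. With CSI a single active interferer already pushes
  the interference term above \<open>T\<close>, since \<open>b \<ge> 1\<close>; bounding the interference-free case by its noiseless
  value gives at most \<open>p A\<^sup>m + e ((A + u)\<^sup>m - A\<^sup>m)\<close> with \<open>u = p powr b * v\<close>. Convexity of the \<open>m\<close>-th power
  shows that the interference term is smaller with CSI by at least a multiple of
  \<open>1 - p powr (b - 1)\<close>, which is of order \<open>A\<close>; this absorbs the noise gain \<open>p A\<^sup>m (1 - e)\<close>
  uniformly in \<open>p \<ge> p0\<close> once \<open>\<nu>\<close> is small.
\<close>

section \<open>The exponential gain: tails and truncated Laplace transforms\<close>

lemma sets_rayleigh_gain [measurable_cong, simp]: "sets rayleigh_gain = sets borel"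
  by (simp add: rayleigh_gain_def)

lemma space_rayleigh_gain [simp]: "space rayleigh_gain = UNIV"
  by (simp add: rayleigh_gain_def)

lemma measure_exponential_greaterThan:
  assumes "0 < l" "0 \<le> c"
  shows "measure (density lborel (exponential_density l)) {c<..} = exp (- c * l)"
proof -
  let ?D = "density lborel (exponential_density l)"
  interpret prob_space ?D by (rule prob_space_exponential_density) fact
  have "distributed ?D lborel (\<lambda>x. x) (exponential_density l)"
    unfolding distributed_def by (auto intro!: distr_id2 simp: sets_density)
  from exponential_distributedD_gt[OF this assms(2)]
  show ?thesis using assms by (simp add: greaterThan_def)
qed

lemma emeasure_rayleigh_greaterThan:
  assumes "0 \<le> c"
  shows "emeasure rayleigh_gain {c<..} = ennreal (exp (- c))"
proof -
  interpret prob_space rayleigh_gain by (rule prob_space_rayleigh_gain)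
  have "measure rayleigh_gain {c<..} = exp (- c)"
    using measure_exponential_greaterThan[of 1 c] assms by (simp add: rayleigh_gain_def)
  then show ?thesis by (simp add: emeasure_eq_measure)
qed

lemma nn_integral_rayleigh_atMost:
  assumes "0 \<le> T"
  shows "(\<integral>\<^sup>+x. ennreal (of_bool (x \<le> T)) \<partial>rayleigh_gain) = ennreal (1 - exp (- T))"
proof -
  interpret prob_space rayleigh_gain by (rule prob_space_rayleigh_gain)
  have "(\<integral>\<^sup>+x. ennreal (of_bool (x \<le> T)) \<partial>rayleigh_gain) = (\<integral>\<^sup>+x. indicator {..T} x \<partial>rayleigh_gain)"
    by (intro nn_integral_cong) (auto split: split_indicator)
  also have "\<dots> = emeasure rayleigh_gain (space rayleigh_gain - {T<..})"
    by (simp add: Compl_eq_Diff_UNIV[symmetric])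
  also have "\<dots> = ennreal (1 - exp (- T))"
    using emeasure_rayleigh_greaterThan[OF assms]
    by (simp add: emeasure_eq_measure prob_compl del: space_rayleigh_gain)
  finally show ?thesis .
qed

text \<open>Tilting the density \<open>exp (- x)\<close> by \<open>exp (- b * x)\<close> gives, up
  to the factor \<open>1 / (1 + b)\<close>, the exponential density of rate \<open>1 + b\<close>;
  what remains is a tail probability of that law.\<close>

lemma nn_integral_rayleigh_laplace_tail:
  assumes "0 < b" "0 \<le> T"
  shows "(\<integral>\<^sup>+x. ennreal (of_bool (T < x) * exp (- b * x)) \<partial>rayleigh_gain) =
    ennreal (exp (- T * (1 + b)) / (1 + b))"
proof -
  let ?D = "density lborel (exponential_density (1 + b))"
  interpret prob_space ?D by (rule prob_space_exponential_density) (use assms in simp)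
  have "(\<integral>\<^sup>+x. ennreal (of_bool (T < x) * exp (- b * x)) \<partial>rayleigh_gain) =
    (\<integral>\<^sup>+x. ennreal (exponential_density 1 x) * ennreal (of_bool (T < x) * exp (- b * x)) \<partial>lborel)"
    unfolding rayleigh_gain_def by (subst nn_integral_density) auto
  also have "\<dots> = (\<integral>\<^sup>+x. ennreal (1 / (1 + b)) * (ennreal (exponential_density (1 + b) x) * indicator {T<..} x) \<partial>lborel)"
    using assms
    by (intro nn_integral_cong)
       (auto simp: exponential_density_def ennreal_mult[symmetric] mult_exp_exp distrib_left
             split: split_indicator)
  also have "\<dots> = ennreal (1 / (1 + b)) * emeasure ?D {T<..}"
    by (simp add: nn_integral_cmult emeasure_density)
  also have "\<dots> = ennreal (exp (- T * (1 + b)) / (1 + b))"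
    using measure_exponential_greaterThan[of "1 + b" T] assms
    by (simp add: emeasure_eq_measure ennreal_mult[symmetric])
  finally show ?thesis .
qed

text \<open>The factor of a single interferer: below \<open>T\<close> it is silent and contributes
  1, above \<open>T\<close> the tilted tail applies. With \<open>exp (- T) = p\<close> this is the
  CSI factor; with \<open>T = 0\<close> it is the factor \<open>1 / (1 + b)\<close> of a node that
  transmits regardless of its gain.\<close>

lemma nn_integral_rayleigh_laplace_thresholded:
  assumes "0 < b" "0 \<le> T"
  shows "(\<integral>\<^sup>+x. ennreal (exp (- b * (of_bool (T < x) * x))) \<partial>rayleigh_gain) =
    ennreal (1 - exp (- T) + exp (- T * (1 + b)) / (1 + b))"
proof -
  have "(\<integral>\<^sup>+x. ennreal (exp (- b * (of_bool (T < x) * x))) \<partial>rayleigh_gain) =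
    (\<integral>\<^sup>+x. ennreal (of_bool (x \<le> T)) + ennreal (of_bool (T < x) * exp (- b * x)) \<partial>rayleigh_gain)"
    by (intro nn_integral_cong) (simp add: of_bool_def not_less)
  also have "\<dots> = ennreal (1 - exp (- T)) + ennreal (exp (- T * (1 + b)) / (1 + b))"
    using assms by (subst nn_integral_add)
      (auto simp: nn_integral_rayleigh_atMost nn_integral_rayleigh_laplace_tail[simplified])
  also have "\<dots> = ennreal (1 - exp (- T) + exp (- T * (1 + b)) / (1 + b))"
    using assms by (subst ennreal_plus) auto
  finally show ?thesis .
qed

section \<open>Product spaces: isolating one gain, normalisation and measurability\<close>

interpretation rayleigh: product_sigma_finite "\<lambda>_ :: nat. rayleigh_gain"
  using prob_space_rayleigh_gain by (simp add: product_sigma_finite_def prob_space_imp_sigma_finite)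

lemma prob_space_gains: "prob_space (gains n)"
  unfolding gains_def by (intro prob_space_PiM prob_space_rayleigh_gain)

lemma prob_space_decisions: "prob_space (decisions n p)"
  unfolding decisions_def by (intro prob_space_PiM measure_pmf.prob_space_axioms)

text \<open>Fubini with coordinate \<open>i\<close> innermost: for fixed gains of the other nodes,
  capture is a condition on the gain of node \<open>i\<close> alone, and its probability is an
  exponential tail.\<close>

lemma emeasure_gains_isolate:
  assumes "i < n" and [measurable]: "Measurable.pred (gains n) P"
  shows "emeasure (gains n) {X \<in> space (gains n). P X} =
    (\<integral>\<^sup>+x. emeasure rayleigh_gain {y. P (x(i := y))} \<partial>Pi\<^sub>M ({..<n} - {i}) (\<lambda>_. rayleigh_gain))"
proof -
  let ?J = "{..<n} - {i}" and ?A = "{X \<in> space (gains n). P X}"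
  have ins: "insert i ?J = {..<n}" using assms by auto
  have [measurable]: "?A \<in> sets (gains n)" by measurable
  have "emeasure (gains n) ?A = (\<integral>\<^sup>+x. indicator ?A x \<partial>Pi\<^sub>M (insert i ?J) (\<lambda>_. rayleigh_gain))"
    unfolding ins gains_def[symmetric] by simp
  also have "\<dots> = (\<integral>\<^sup>+x. (\<integral>\<^sup>+y. indicator ?A (x(i := y)) \<partial>rayleigh_gain) \<partial>Pi\<^sub>M ?J (\<lambda>_. rayleigh_gain))"
    by (rule rayleigh.product_nn_integral_insert) (simp_all add: ins gains_def[symmetric] del: insert_Diff_single)
  also have "\<dots> = (\<integral>\<^sup>+x. emeasure rayleigh_gain {y. P (x(i := y))} \<partial>Pi\<^sub>M ?J (\<lambda>_. rayleigh_gain))"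
  proof (rule nn_integral_cong)
    fix x assume x: "x \<in> space (Pi\<^sub>M ?J (\<lambda>_. rayleigh_gain))"
    have upd: "(\<lambda>y. x(i := y)) \<in> measurable rayleigh_gain (gains n)"
      using measurable_fun_upd[where J = ?J and i = i and M = "\<lambda>_. rayleigh_gain" and I = "{..<n}"
          and f = "\<lambda>_. x" and h = "\<lambda>y. y" and N = rayleigh_gain] x ins
      by (auto simp: gains_def)
    have "x(i := y) \<in> space (gains n)" for y
      using measurable_space[OF upd] by simp
    moreover have "{y. P (x(i := y))} \<in> sets rayleigh_gain"
      using measurable_compose[OF upd, of P] assms(2)
      by (simp add: pred_def)
    ultimately show "(\<integral>\<^sup>+y. indicator ?A (x(i := y)) \<partial>rayleigh_gain) = emeasure rayleigh_gain {y. P (x(i := y))}"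
      unfolding nn_integral_indicator[OF \<open>_ \<in> sets rayleigh_gain\<close>, symmetric]
      by (intro nn_integral_cong) (simp split: split_indicator)
  qed
  finally show ?thesis .
qed

text \<open>Dividing by the positive power \<open>PT\<close> shows that noise and power enter only
  through \<open>N0 / PT\<close>.\<close>

lemma captured_normalized:
  assumes "0 < PT"
  shows "captured n b N0 PT B X i \<longleftrightarrow>
    b * ((\<Sum>j\<in>{..<n} - {i}. of_bool (B j) * X j) + N0 / PT) < of_bool (B i) * X i"
proof -
  define S where "S = (\<Sum>j\<in>{..<n} - {i}. of_bool (B j) * X j)"
  have "(\<Sum>j\<in>{..<n} - {i}. of_bool (B j) * X j * PT) = S * PT"
    unfolding S_def by (rule sum_distrib_right[symmetric])
  then have "b * ((\<Sum>j\<in>{..<n} - {i}. of_bool (B j) * X j * PT) + N0) = (b * (S + N0 / PT)) * PT"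
    using assms by (simp add: field_simps)
  then show ?thesis
    unfolding captured_def S_def[symmetric] using assms by (simp only: mult_less_cancel_right_pos)
qed

lemma borel_measurable_gain:
  assumes "j < n"
  shows "(\<lambda>X. X j) \<in> borel_measurable (gains n)"
proof -
  have "j \<in> {..<n}" using assms by simp
  then show ?thesis unfolding gains_def by measurable
qed

lemma pred_decision:
  assumes "j < n"
  shows "Measurable.pred (decisions n p) (\<lambda>B. B j)"
proof -
  have "j \<in> {..<n}" using assms by simp
  from measurable_component_singleton[OF this, of "\<lambda>_. measure_pmf (bernoulli_pmf p)"]
  show ?thesis by (simp add: decisions_def pred_def measurable_def)
qed

lemma pred_captured_decision:
  assumes "i < n"
  shows "Measurable.pred (gains n) (\<lambda>X. captured n b N0 PT B X i)"
proof -
  note [measurable] = borel_measurable_gain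
  show ?thesis unfolding captured_def using assms by measurable
qed

lemma pred_captured_threshold:
  assumes "i < n"
  shows "Measurable.pred (gains n) (\<lambda>X. captured n b N0 PT (\<lambda>j. t < ereal (X j)) X i)"
proof -
  note [measurable] = borel_measurable_gain
  show ?thesis unfolding captured_def using assms by measurable
qed

lemma pred_captured_pair:
  assumes "i < n"
  shows "Measurable.pred (gains n \<Otimes>\<^sub>M decisions n p) (\<lambda>\<omega>. captured n b N0 PT (snd \<omega>) (fst \<omega>) i)"
proof -
  have [measurable]: "(\<lambda>\<omega>. fst \<omega> j) \<in> borel_measurable (gains n \<Otimes>\<^sub>M decisions n p)"
    "Measurable.pred (gains n \<Otimes>\<^sub>M decisions n p) (\<lambda>\<omega>. snd \<omega> j)" if "j < n" for j
    using measurable_compose[OF measurable_fst borel_measurable_gain[OF that]]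
      measurable_compose[OF measurable_snd pred_decision[OF that]] by auto
  show ?thesis unfolding captured_def using assms by measurable
qed

section \<open>Factorisation over the interferers and bounds for both throughputs\<close>

lemma nn_integral_rayleigh_prod:
  fixes J :: "nat set"
  assumes "finite J" and f: "f \<in> borel_measurable borel" "\<And>x. 0 \<le> f x"
    and int: "(\<integral>\<^sup>+x. ennreal (f x) \<partial>rayleigh_gain) = ennreal v" and "0 \<le> v" "0 \<le> c"
  shows "(\<integral>\<^sup>+x. ennreal (c * (\<Prod>j\<in>J. f (x j))) \<partial>Pi\<^sub>M J (\<lambda>_. rayleigh_gain)) =
    ennreal (c * v ^ card J)"
proof -
  let ?M = "Pi\<^sub>M J (\<lambda>_ :: nat. rayleigh_gain)"
  have [measurable]: "f \<in> borel_measurable borel" by fact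
  have "(\<integral>\<^sup>+x. ennreal (c * (\<Prod>j\<in>J. f (x j))) \<partial>?M) = (\<integral>\<^sup>+x. ennreal c * (\<Prod>j\<in>J. ennreal (f (x j))) \<partial>?M)"
    using assms by (simp add: ennreal_mult prod_nonneg prod_ennreal)
  also have "\<dots> = ennreal c * (\<integral>\<^sup>+x. (\<Prod>j\<in>J. ennreal (f (x j))) \<partial>?M)"
    using \<open>finite J\<close> by (intro nn_integral_cmult) measurable
  also have "(\<integral>\<^sup>+x. (\<Prod>j\<in>J. ennreal (f (x j))) \<partial>?M) = (\<Prod>j\<in>J. \<integral>\<^sup>+x. ennreal (f x) \<partial>rayleigh_gain)"
    using \<open>finite J\<close> by (intro rayleigh.product_nn_integral_prod) measurable
  also have "ennreal c * \<dots> = ennreal (c * v ^ card J)"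
    using assms by (simp add: int ennreal_mult ennreal_power)
  finally show ?thesis .
qed

text \<open>Separates the noise factor from one factor per interferer, so that independence can be
  used.\<close>

lemma exp_neg_affine_sum:
  fixes b \<nu> :: real
  assumes "finite J"
  shows "exp (- (b * ((\<Sum>j\<in>J. y j) + \<nu>))) = exp (- b * \<nu>) * (\<Prod>j\<in>J. exp (- b * y j))"
  using assms
  by (simp add: exp_sum[symmetric] mult_exp_exp sum_distrib_left[symmetric] sum_negf algebra_simps)

text \<open>Given the other gains, node \<open>i\<close> succeeds iff its own gain exceeds
  \<open>max T (c x)\<close>. If no interferer is active this has probability at most
  \<open>p\<close>; otherwise the interference term dominates and the exponential factorises. The
  term \<open>e * (1 - p) ^ (n - 1)\<close> stands on the left so that no subtraction of
  \<open>ennreal\<close> integrals occurs.\<close>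

lemma r_csi_le:
  assumes "i < n" "1 \<le> b" "0 \<le> N0" "0 < PT" "0 < p" "p \<le> 1"
  defines "e \<equiv> exp (- b * (N0 / PT))"
  shows "r_csi n b N0 PT p i + e * (1 - p) ^ (n - 1) \<le>
    p * (1 - p) ^ (n - 1) + e * (1 - p + p powr (1 + b) / (1 + b)) ^ (n - 1)"
proof -
  define T where "T = - ln p"
  define J where "J = {..<n} - {i}"
  define M where "M = Pi\<^sub>M J (\<lambda>_ :: nat. rayleigh_gain)"
  define \<nu> where "\<nu> = N0 / PT"
  define c where "c x = b * ((\<Sum>j\<in>J. of_bool (T < x j) * x j) + \<nu>)" for x :: "nat \<Rightarrow> real"
  define P where "P X = captured n b N0 PT (\<lambda>j. csi_threshold p < ereal (X j)) X i" for X
  define q where "q = 1 - p + p powr (1 + b) / (1 + b)"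
  define none where "none x = (\<Prod>j\<in>J. of_bool (x j \<le> T) :: real)" for x :: "nat \<Rightarrow> real"
  interpret gains: prob_space "gains n" by (rule prob_space_gains)
  have T: "0 \<le> T" "exp (- T) = p" using assms by (auto simp: T_def)
  have pT: "exp (- T * (1 + b)) = p powr (1 + b)"
    using assms by (simp add: T_def powr_def algebra_simps)
  have \<nu>: "0 \<le> \<nu>" using assms by (simp add: \<nu>_def)
  have J: "finite J" "card J = n - 1" "i \<notin> J" using assms by (auto simp: J_def)
  have q: "0 \<le> q" using assms by (simp add: q_def)
  \<comment> \<open>Coordinates of the product space may be negative, but an active interferer has
    \<open>x j > T\<close>, hence a nonnegative gain.\<close>
  have c0: "0 \<le> c x" for x
  proof -
    have "0 \<le> (\<Sum>j\<in>J. of_bool (T < x j) * x j)"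
      using T by (intro sum_nonneg) (simp add: of_bool_def)
    then show ?thesis using assms \<nu> by (simp add: c_def)
  qed
  have thr: "csi_threshold p < ereal y \<longleftrightarrow> T < y" for y
    using assms by (simp add: csi_threshold_def T_def)
  have sec: "{y. P (x(i := y))} = {max T (c x)<..}" for x
  proof -
    have "(\<Sum>j\<in>J. of_bool (T < (x(i := y)) j) * (x(i := y)) j) = (\<Sum>j\<in>J. of_bool (T < x j) * x j)" for y
      using J by (intro sum.cong) auto
    then have "P (x(i := y)) \<longleftrightarrow> c x < of_bool (T < y) * y" for y
      by (simp add: P_def captured_normalized[OF \<open>0 < PT\<close>] thr c_def J_def[symmetric] \<nu>_def)
    \<comment> \<open>A silent node \<open>i\<close> has left-hand side 0, which cannot exceed
      \<open>c x\<close>; an active one needs a gain above both \<open>T\<close> and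
      \<open>c x\<close>.\<close>
    moreover have "c x < of_bool (T < y) * y \<longleftrightarrow> max T (c x) < y" for y
      using c0[of x] T by (cases "T < y") auto
    ultimately show ?thesis by (simp only: greaterThan_def)
  qed
  have P: "Measurable.pred (gains n) P"
    using pred_captured_threshold[OF \<open>i < n\<close>] by (simp add: P_def[abs_def])
  have csi: "ennreal (r_csi n b N0 PT p i) = (\<integral>\<^sup>+x. ennreal (exp (- max T (c x))) \<partial>M)"
  proof -
    have "ennreal (r_csi n b N0 PT p i) = emeasure (gains n) {X \<in> space (gains n). P X}"
      by (simp add: r_csi_def P_def gains.emeasure_eq_measure)
    also have "\<dots> = (\<integral>\<^sup>+x. emeasure rayleigh_gain {max T (c x)<..} \<partial>M)"
      using emeasure_gains_isolate[OF \<open>i < n\<close> P] by (simp only: sec M_def J_def)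
    finally show ?thesis using T by (simp add: emeasure_rayleigh_greaterThan)
  qed
  \<comment> \<open>\<open>none\<close> is the indicator that every interferer is silent. If one is
    active, \<open>none\<close> vanishes and both sides agree; if all are silent, the product of
    exponentials is 1 and only \<open>exp (- max T (c x)) \<le> p\<close> remains.\<close>
  have pointwise: "exp (- max T (c x)) + e * none x \<le>
      p * none x + e * (\<Prod>j\<in>J. exp (- b * (of_bool (T < x j) * x j)))" for x
  proof (cases "\<exists>k\<in>J. T < x k")
    case True
    then obtain k where k: "k \<in> J" "T < x k" by blast
    then have "none x = 0" using J unfolding none_def by (intro prod_zero bexI[of _ k]) auto
    have "T \<le> x k" using k by simp
    also have "x k = of_bool (T < x k) * x k" using k by simp
    also have "\<dots> \<le> (\<Sum>j\<in>J. of_bool (T < x j) * x j)"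
      using J k T by (intro member_le_sum) auto
    also have "\<dots> \<le> (\<Sum>j\<in>J. of_bool (T < x j) * x j) + \<nu>" using \<nu> by simp
    finally have "T \<le> (\<Sum>j\<in>J. of_bool (T < x j) * x j) + \<nu>" .
    \<comment> \<open>The capture ratio enters here: interference already at least \<open>T\<close>
      cannot fall below \<open>T\<close> when scaled by \<open>b \<ge> 1\<close>.\<close>
    then have "1 * T \<le> c x" unfolding c_def using assms T by (intro mult_mono) auto
    then have "exp (- max T (c x)) = exp (- c x)" by (simp add: max_def)
    also have "\<dots> = e * (\<Prod>j\<in>J. exp (- b * (of_bool (T < x j) * x j)))"
      unfolding c_def exp_neg_affine_sum[OF J(1)] e_def \<nu>_def ..
    finally show ?thesis using \<open>none x = 0\<close> by simp
  next
    case False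
    then have "none x = 1" by (auto simp: none_def intro!: prod.neutral)
    moreover have "(\<Prod>j\<in>J. exp (- b * (of_bool (T < x j) * x j))) = 1"
      using False by (intro prod.neutral) auto
    moreover have "exp (- max T (c x)) \<le> exp (- T)" by simp
    ultimately show ?thesis using T by simp
  qed
  have [measurable]: "(\<lambda>x. x j) \<in> borel_measurable M" if "j \<in> J" for j
    using that unfolding M_def by measurable
  have [measurable]: "c \<in> borel_measurable M" "none \<in> borel_measurable M"
    unfolding c_def none_def by measurable
  have none_int: "(\<integral>\<^sup>+x. ennreal (a * none x) \<partial>M) = ennreal (a * (1 - p) ^ (n - 1))" if "0 \<le> a" for a
    unfolding none_def M_def J(2)[symmetric]
    using nn_integral_rayleigh_atMost[OF T(1)] T that J assms
    by (intro nn_integral_rayleigh_prod) auto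
  have all_int: "(\<integral>\<^sup>+x. ennreal (e * (\<Prod>j\<in>J. exp (- b * (of_bool (T < x j) * x j)))) \<partial>M) = ennreal (e * q ^ (n - 1))"
    unfolding M_def J(2)[symmetric]
  proof (rule nn_integral_rayleigh_prod)
    show "(\<integral>\<^sup>+x. ennreal (exp (- b * (of_bool (T < x) * x))) \<partial>rayleigh_gain) = ennreal q"
      using nn_integral_rayleigh_laplace_thresholded[of b T] T assms pT by (simp add: q_def)
  qed (use J q in \<open>auto simp: e_def\<close>)
  have none_nonneg: "0 \<le> none x" for x by (auto simp: none_def intro!: prod_nonneg)
  have "ennreal (r_csi n b N0 PT p i + e * (1 - p) ^ (n - 1)) =
      (\<integral>\<^sup>+x. ennreal (exp (- max T (c x))) \<partial>M) + (\<integral>\<^sup>+x. ennreal (e * none x) \<partial>M)"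
    using assms by (simp add: none_int csi[symmetric] r_csi_def)
  also have "\<dots> = (\<integral>\<^sup>+x. ennreal (exp (- max T (c x)) + e * none x) \<partial>M)"
    using none_nonneg by (simp add: nn_integral_add e_def)
  also have "\<dots> \<le> (\<integral>\<^sup>+x. ennreal (p * none x + e * (\<Prod>j\<in>J. exp (- b * (of_bool (T < x j) * x j)))) \<partial>M)"
    using pointwise by (intro nn_integral_mono ennreal_leI)
  also have "\<dots> = (\<integral>\<^sup>+x. ennreal (p * none x) \<partial>M) + (\<integral>\<^sup>+x. ennreal (e * (\<Prod>j\<in>J. exp (- b * (of_bool (T < x j) * x j)))) \<partial>M)"
    using none_nonneg assms J
    by (subst nn_integral_add[symmetric]) (auto simp: prod_nonneg)
  also have "\<dots> = ennreal (p * (1 - p) ^ (n - 1) + e * q ^ (n - 1))"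
    unfolding all_int none_int[OF less_imp_le[OF \<open>0 < p\<close>]]
    using assms q by (intro ennreal_plus[symmetric]) auto
  finally show ?thesis
    using assms q by (subst (asm) ennreal_le_iff) (auto simp: q_def)
qed

text \<open>For fixed decisions the gains of the interferers are integrated out as with CSI; the
  resulting product is then averaged over the independent Bernoulli decisions.\<close>

lemma r_no_ge:
  assumes "i < n" "0 < b" "0 \<le> N0" "0 < PT" "0 \<le> p" "p \<le> 1"
  shows "p * exp (- b * (N0 / PT)) * (1 - p + p / (1 + b)) ^ (n - 1) \<le> r_no n b N0 PT p i"
proof -
  define J where "J = {..<n} - {i}"
  define M where "M = Pi\<^sub>M J (\<lambda>_ :: nat. rayleigh_gain)"
  define \<nu> where "\<nu> = N0 / PT"
  define e where "e = exp (- b * \<nu>)"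
  \<comment> \<open>\<open>w t\<close> is the Laplace transform at \<open>b\<close> of an
    interferer's contribution under decision \<open>t\<close>. \<open>f\<close> replaces it at node
    \<open>i\<close> by the indicator of transmission, so the product of \<open>f\<close> over all
    nodes, times \<open>e\<close>, is the success probability given the decisions.\<close>
  define w where "w t = (if t then 1 / (1 + b) else 1)" for t
  define f where "f j t = (if j = i then of_bool t else w t)" for j t
  interpret gains: prob_space "gains n" by (rule prob_space_gains)
  interpret decisions: prob_space "decisions n p" by (rule prob_space_decisions)
  interpret pair_prob_space "gains n" "decisions n p" ..
  interpret bernoulli: product_sigma_finite "\<lambda>_ :: nat. measure_pmf (bernoulli_pmf p)"
    by (simp add: product_sigma_finite_def prob_space_imp_sigma_finite measure_pmf.prob_space_axioms)
  have \<nu>: "0 \<le> \<nu>" using assms by (simp add: \<nu>_def)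
  have J: "finite J" "card J = n - 1" "i \<notin> J" "{..<n} = insert i J" using assms by (auto simp: J_def)
  have w0: "0 \<le> w t" for t using assms by (simp add: w_def)
  have f0: "0 \<le> f j t" for j t using w0 by (simp add: f_def)
  have fixed_decision: "ennreal (e * (\<Prod>j<n. f j (B j))) \<le>
      emeasure (gains n) {X \<in> space (gains n). captured n b N0 PT B X i}" for B
  proof (cases "B i")
    case False
    then have "f i (B i) = 0" by (simp add: f_def)
    then have "(\<Prod>j<n. f j (B j)) = 0" using \<open>i < n\<close> by (intro prod_zero) auto
    then show ?thesis by (simp only: mult_zero_right ennreal_0 zero_le)
  next
    case True
    \<comment> \<open>Gains are nonnegative only almost surely. Clipping the interferers at \<open>0\<close> can only
      increase the interference, and a lower bound for the throughput is all that is needed.\<close>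
    define y where "y x j = of_bool (B j) * (of_bool (0 < x j) * x j)" for x :: "nat \<Rightarrow> real" and j
    define c where "c x = b * ((\<Sum>j\<in>J. y x j) + \<nu>)" for x
    have "0 \<le> c x" for x
    proof -
      have "0 \<le> (\<Sum>j\<in>J. y x j)" by (intro sum_nonneg) (simp add: y_def of_bool_def)
      then show ?thesis using assms \<nu> by (simp add: c_def)
    qed
    note c0 = emeasure_rayleigh_greaterThan[OF this]
    have sub: "{c x<..} \<subseteq> {y. captured n b N0 PT B (x(i := y)) i}" for x
    proof
      fix z assume "z \<in> {c x<..}"
      moreover have "(\<Sum>j\<in>J. of_bool (B j) * (x(i := z)) j) \<le> (\<Sum>j\<in>J. y x j)"
        using J by (intro sum_mono) (auto simp: y_def)
      then have "b * ((\<Sum>j\<in>J. of_bool (B j) * (x(i := z)) j) + \<nu>) \<le> c x"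
        using assms by (auto simp: c_def)
      ultimately show "z \<in> {y. captured n b N0 PT B (x(i := y)) i}"
        using True by (simp add: captured_normalized[OF \<open>0 < PT\<close>] J_def[symmetric] \<nu>_def)
    qed
    \<comment> \<open>Clipping at 0 is thresholding with \<open>T = 0\<close>; a silent interferer
      leaves the constant integrand 1.\<close>
    have w_int: "(\<integral>\<^sup>+z. ennreal (exp (- b * (of_bool t * (of_bool (0 < z) * z)))) \<partial>rayleigh_gain) = ennreal (w t)" for t
      using nn_integral_rayleigh_laplace_thresholded[of b 0] assms prob_space.emeasure_space_1[OF prob_space_rayleigh_gain]
      by (cases t) (auto simp: w_def)
    have "(\<Prod>j<n. f j (B j)) = (\<Prod>j\<in>J. w (B j))"
      using J True by (simp add: f_def) (intro prod.cong, auto)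
    then have "ennreal (e * (\<Prod>j<n. f j (B j))) = ennreal e * (\<Prod>j\<in>J. ennreal (w (B j)))"
      using w0 by (simp add: ennreal_mult prod_ennreal prod_nonneg e_def)
    also have "\<dots> = ennreal e * (\<integral>\<^sup>+x. (\<Prod>j\<in>J. ennreal (exp (- b * y x j))) \<partial>M)"
    proof -
      have "(\<integral>\<^sup>+x. (\<Prod>j\<in>J. ennreal (exp (- b * y x j))) \<partial>M) =
          (\<Prod>j\<in>J. \<integral>\<^sup>+z. ennreal (exp (- b * (of_bool (B j) * (of_bool (0 < z) * z)))) \<partial>rayleigh_gain)"
        unfolding y_def M_def using J(1) by (intro rayleigh.product_nn_integral_prod) measurable
      then show ?thesis by (simp only: w_int)
    qed
    also have "\<dots> = (\<integral>\<^sup>+x. ennreal e * (\<Prod>j\<in>J. ennreal (exp (- b * y x j))) \<partial>M)"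
      unfolding y_def M_def using J by (intro nn_integral_cmult[symmetric]) measurable
    also have "\<dots> = (\<integral>\<^sup>+x. ennreal (exp (- c x)) \<partial>M)"
      unfolding c_def exp_neg_affine_sum[OF J(1)]
      by (simp add: ennreal_mult prod_ennreal prod_nonneg e_def)
    also have "\<dots> = (\<integral>\<^sup>+x. emeasure rayleigh_gain {c x<..} \<partial>M)" by (simp add: c0)
    also have "\<dots> \<le> (\<integral>\<^sup>+x. emeasure rayleigh_gain {y. captured n b N0 PT B (x(i := y)) i} \<partial>M)"
    proof (intro nn_integral_mono emeasure_mono sub)
      fix x
      \<comment> \<open>Monotonicity of \<open>emeasure\<close> needs the larger set to be
        measurable; it is the half-line determined by the unclipped interference.\<close>
      have "{y. captured n b N0 PT B (x(i := y)) i} = {b * ((\<Sum>j\<in>J. of_bool (B j) * x j) + \<nu>)<..}"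
      proof -
        have "(\<Sum>j\<in>J. of_bool (B j) * (x(i := y)) j) = (\<Sum>j\<in>J. of_bool (B j) * x j)" for y
          using J by (intro sum.cong) auto
        then show ?thesis
          using True by (auto simp: captured_normalized[OF \<open>0 < PT\<close>] J_def[symmetric] \<nu>_def)
      qed
      then show "{y. captured n b N0 PT B (x(i := y)) i} \<in> sets rayleigh_gain" by simp
    qed
    also have "\<dots> = emeasure (gains n) {X \<in> space (gains n). captured n b N0 PT B X i}"
      unfolding M_def J_def
      by (rule emeasure_gains_isolate[symmetric]) (use \<open>i < n\<close> pred_captured_decision in auto)
    finally show ?thesis .
  qed
  let ?A = "{\<omega> \<in> space (gains n \<Otimes>\<^sub>M decisions n p). captured n b N0 PT (snd \<omega>) (fst \<omega>) i}"
  have A: "?A \<in> sets (gains n \<Otimes>\<^sub>M decisions n p)"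
    using pred_captured_pair[OF \<open>i < n\<close>] by (simp add: pred_def)
  have f_int: "(\<integral>\<^sup>+t. ennreal (f j t) \<partial>measure_pmf (bernoulli_pmf p)) =
      ennreal (if j = i then p else 1 - p + p / (1 + b))" for j
    using assms by (simp add: f_def w_def nn_integral_bernoulli_pmf ennreal_mult[symmetric] ennreal_plus[symmetric] algebra_simps
      del: ennreal_plus)
  have "ennreal (p * e * (1 - p + p / (1 + b)) ^ (n - 1)) =
      ennreal e * (\<Prod>j<n. ennreal (if j = i then p else 1 - p + p / (1 + b)))"
  proof -
    have "(\<Prod>j<n. if j = i then p else 1 - p + p / (1 + b)) = p * (1 - p + p / (1 + b)) ^ (n - 1)"
      using J by (simp add: J(2)[symmetric]) (subst prod.cong[OF refl, of _ _ "\<lambda>_. 1 - p + p / (1 + b)"], auto)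
    moreover have "0 \<le> 1 - p + p / (1 + b)" using assms by simp
    ultimately show ?thesis
      using assms by (subst prod_ennreal) (simp_all add: ennreal_mult[symmetric] e_def mult.left_commute mult.assoc)
  qed
  also have "\<dots> = ennreal e * (\<integral>\<^sup>+B. (\<Prod>j<n. ennreal (f j (B j))) \<partial>decisions n p)"
    unfolding decisions_def f_int[symmetric]
    by (subst bernoulli.product_nn_integral_prod) auto
  also have "\<dots> = (\<integral>\<^sup>+B. ennreal e * (\<Prod>j<n. ennreal (f j (B j))) \<partial>decisions n p)"
    unfolding decisions_def by (intro nn_integral_cmult[symmetric]) measurable
  also have "\<dots> = (\<integral>\<^sup>+B. ennreal (e * (\<Prod>j<n. f j (B j))) \<partial>decisions n p)"
    using f0 by (simp add: ennreal_mult prod_ennreal prod_nonneg e_def)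
  \<comment> \<open>Gains are integrated inside and decisions outside, so the inner measure is that
    of a section at fixed \<open>B\<close>, where \<open>fixed_decision\<close> applies.\<close>
  also have "\<dots> \<le> (\<integral>\<^sup>+B. emeasure (gains n) ((\<lambda>X. (X, B)) -` ?A) \<partial>decisions n p)"
  proof (intro nn_integral_mono)
    fix B assume "B \<in> space (decisions n p)"
    then have "(\<lambda>X. (X, B)) -` ?A = {X \<in> space (gains n). captured n b N0 PT B X i}"
      by (auto simp: space_pair_measure)
    then show "ennreal (e * (\<Prod>j<n. f j (B j))) \<le> emeasure (gains n) ((\<lambda>X. (X, B)) -` ?A)"
      using fixed_decision[of B] by simp
  qed
  also have "\<dots> = ennreal (r_no n b N0 PT p i)"
    unfolding r_no_def using emeasure_pair_measure_alt2[OF A] by (simp add: emeasure_eq_measure)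
  finally show ?thesis
    by (subst (asm) ennreal_le_iff) (auto simp: r_no_def e_def \<nu>_def)
qed

section \<open>Real inequalities comparing the two bounds\<close>

lemma power_segment_le:
  fixes A v t :: real
  assumes "0 \<le> A" "0 \<le> v" "0 \<le> t" "t \<le> 1"
  shows "(A + t * v) ^ m \<le> (1 - t) * A ^ m + t * (A + v) ^ m"
proof (induction m)
  case (Suc m)
  have "(A + t * v) * (A + t * v) ^ m \<le> (A + t * v) * ((1 - t) * A ^ m + t * (A + v) ^ m)"
    using Suc assms by (intro mult_left_mono) auto
  \<comment> \<open>The induction step for convexity leaves an explicit defect, a nonnegative
    multiple of \<open>(A + v) ^ m - A ^ m\<close>.\<close>
  also have "\<dots> = (1 - t) * A ^ Suc m + t * (A + v) ^ Suc m - t * (1 - t) * v * ((A + v) ^ m - A ^ m)"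
    by (simp add: algebra_simps)
  also have "\<dots> \<le> (1 - t) * A ^ Suc m + t * (A + v) ^ Suc m"
    using assms power_mono[of A "A + v" m] by simp
  finally show ?case by simp
qed simp

text \<open>A crude linear bound suffices: its \<open>A ^ (m - 1)\<close> combines with the factor
  \<open>1 - p\<close> supplied by \<open>one_minus_powr_ge\<close> to restore \<open>A ^ m\<close>,
  the weight of the interference-free case.\<close>

lemma power_add_ge:
  fixes A v :: real
  assumes "0 \<le> A" "0 \<le> v" "1 \<le> m"
  shows "A ^ (m - 1) * v \<le> (A + v) ^ m - A ^ m"
proof -
  obtain k where k: "m = Suc k" using assms by (cases m) auto
  have "A ^ k * (A + v) \<le> (A + v) ^ k * (A + v)"
    using assms by (intro mult_right_mono power_mono) auto
  then show ?thesis by (simp add: k algebra_simps)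
qed

text \<open>For \<open>a \<le> 1\<close> the concave power lies below its tangent at 1, which is
  Young's inequality with second argument 1. For \<open>a > 1\<close> it lies below \<open>p\<close>
  itself, whence the minimum.\<close>

lemma one_minus_powr_ge:
  fixes p a :: real
  assumes "0 < p" "p \<le> 1" "0 < a"
  shows "min 1 a * (1 - p) \<le> 1 - p powr a"
proof (cases "a \<le> 1")
  case True
  have "p powr a \<le> 1 + a * (p - 1)"
    using Youngs_inequality_0[of a "1 - a" p 1] assms True by (simp add: algebra_simps)
  then show ?thesis using True by (simp add: algebra_simps)
next
  case False
  then have "p powr a \<le> p powr 1" using assms by (intro powr_mono') auto
  then show ?thesis using assms False by simp
qed

text \<open>Compares the bounds of \<open>r_csi_le\<close> and \<open>r_no_ge\<close> with
  \<open>m = n - 1\<close>. The assumption \<open>small\<close> bounds the noise loss by the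
  guaranteed gap in the interference terms.\<close>

lemma throughput_gap:
  fixes p b e :: real
  assumes p: "0 < p" "p \<le> 1" and "1 < b" "1 \<le> m" "0 < e"
    and small: "1 - e \<le> e * (p * min 1 (b - 1) / (1 + b))"
  shows "p * (1 - p) ^ m + e * (1 - p + p powr (1 + b) / (1 + b)) ^ m \<le>
    e * (1 - p) ^ m + p * e * (1 - p + p / (1 + b)) ^ m"
proof -
  \<comment> \<open>With \<open>s = p powr (b - 1)\<close> the CSI increment equals
    \<open>p * s * v\<close>, so convexity bounds its interference term by \<open>p * s * D\<close>,
    against \<open>p * D\<close> without CSI. The margin \<open>p * (1 - s) * D\<close>, weighted by
    \<open>e\<close>, must cover \<open>p * A ^ m * (1 - e)\<close>.\<close>
  define A v s where "A = 1 - p" and "v = p / (1 + b)" and "s = p powr (b - 1)"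
  have A: "0 \<le> A" and v: "0 \<le> v" using assms by (auto simp: A_def v_def)
  have s: "0 \<le> s" "s \<le> 1" using assms by (auto simp: s_def powr_le1)
  have ps: "0 \<le> p * s" "p * s \<le> 1" using p s by (auto intro!: mult_le_one)
  have "p powr (1 + b) = p * s * p"
    using p by (simp add: s_def powr_add powr_diff)
  then have u: "p powr (1 + b) / (1 + b) = p * s * v" by (simp add: v_def)
  define D where "D = (A + v) ^ m - A ^ m"
  have "(A + p * s * v) ^ m \<le> A ^ m + p * s * D"
    using power_segment_le[OF A v ps, of m] by (simp add: D_def algebra_simps)
  moreover have "A ^ m * (1 - e) \<le> e * ((1 - s) * D)"
  proof -
    have "A ^ m * (1 - e) \<le> A ^ m * (e * (p * min 1 (b - 1) / (1 + b)))"
      using small A by (intro mult_left_mono) auto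
    \<comment> \<open>Splits \<open>A ^ m\<close> as \<open>A * A ^ (m - 1)\<close>, which requires
      \<open>m \<ge> 1\<close>, and writes \<open>p / (1 + b)\<close> as \<open>v\<close>.\<close>
    also have "\<dots> = e * (min 1 (b - 1) * A * (A ^ (m - 1) * v))"
      using \<open>1 \<le> m\<close> by (cases m) (auto simp: v_def)
    also have "\<dots> \<le> e * ((1 - s) * (A ^ (m - 1) * v))"
      using one_minus_powr_ge[of p "b - 1"] assms A v
      by (intro mult_left_mono mult_right_mono) (auto simp: A_def s_def)
    also have "\<dots> \<le> e * ((1 - s) * D)"
      using power_add_ge[OF A v \<open>1 \<le> m\<close>] s assms by (intro mult_left_mono) (auto simp: D_def)
    finally show ?thesis .
  qed
  then have "p * (A ^ m * (1 - e)) \<le> p * (e * ((1 - s) * D))"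
    using p by (intro mult_left_mono) auto
  ultimately have "p * A ^ m + e * (A + p * s * v) ^ m \<le> p * (e * ((1 - s) * D)) + p * A ^ m * e + e * (A ^ m + p * s * D)"
    using mult_left_mono[of "(A + p * s * v) ^ m" "A ^ m + p * s * D" e] assms
    by (simp add: algebra_simps)
  also have "\<dots> = e * A ^ m + p * e * (A + v) ^ m" by (simp add: D_def algebra_simps)
  finally show ?thesis by (simp add: A_def v_def[symmetric] u)
qed

section \<open>The silent case and the choice of the noise bound\<close>

lemma r_csi_0:
  assumes "0 < b" "0 \<le> N0"
  shows "r_csi n b N0 PT 0 i = 0"
proof -
  have "\<not> b * N0 < 0" using assms by (simp add: not_less)
  then show ?thesis by (simp add: r_csi_def csi_threshold_def captured_def)
qed

text \<open>For fixed positive noise the advantage of transmitting only at high gain is of first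
  order in \<open>p\<close>, while the interference gap is of second order. Hence no noise bound
  serves all \<open>p\<close> near 0, and \<open>\<epsilon>\<close> depends on \<open>p0\<close>. At
  least two nodes are required because a lone node with CSI reaches the minimum of \<open>p\<close>
  and \<open>e\<close>, which exceeds \<open>p * e\<close> when both lie strictly between 0 and
  1.\<close>

theorem theorem2:
  fixes n :: nat and b p0 :: real
  assumes "2 \<le> n" and "1 < b" and "0 < p0"
  shows "\<exists>\<epsilon>>0. \<forall>N0 PT. 0 \<le> N0 \<and> 0 < PT \<and> N0 / PT < \<epsilon> \<longrightarrow>
           (\<forall>p\<in>{0..1}. p = 0 \<or> p0 \<le> p \<longrightarrow>
             (\<forall>i<n. r_csi n b N0 PT p i \<le> r_no n b N0 PT p i))"
proof -
  \<comment> \<open>\<open>d\<close> is the coefficient in the smallness condition of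
    \<open>throughput_gap\<close> at the worst case \<open>p = p0\<close>. \<open>\<epsilon>\<close>
    is chosen so that \<open>exp (b * (N0 / PT)) < 1 + d\<close>, which after multiplication by
    \<open>e\<close> gives \<open>1 - e \<le> e * d\<close>.\<close>
  define d where "d = p0 * min 1 (b - 1) / (1 + b)"
  define \<epsilon> where "\<epsilon> = ln (1 + d) / b"
  have d: "0 < d" using assms by (simp add: d_def)
  have "0 < \<epsilon>" using d assms by (simp add: \<epsilon>_def)
  moreover have "r_csi n b N0 PT p i \<le> r_no n b N0 PT p i"
    if N: "0 \<le> N0" "0 < PT" "N0 / PT < \<epsilon>" and p: "p \<in> {0..1}" "p = 0 \<or> p0 \<le> p" and "i < n"
    for N0 PT p i
  proof (cases "p = 0")
    case True
    then show ?thesis using assms N by (simp add: r_csi_0 r_no_def)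
  next
    case False
    define e where "e = exp (- b * (N0 / PT))"
    have e: "0 < e" by (simp add: e_def)
    have "b * (N0 / PT) < ln (1 + d)"
      using N assms by (simp add: \<epsilon>_def field_simps)
    then have "exp (b * (N0 / PT)) < 1 + d"
      using d by (metis add_pos_pos exp_less_mono exp_ln zero_less_one)
    then have "e * exp (b * (N0 / PT)) \<le> e * (1 + d)" using e by simp
    then have "1 - e \<le> e * d" by (simp add: e_def mult_exp_exp algebra_simps)
    also have "\<dots> \<le> e * (p * min 1 (b - 1) / (1 + b))"
      unfolding d_def using assms p False e by (intro mult_left_mono divide_right_mono mult_right_mono) auto
    finally have small: "1 - e \<le> e * (p * min 1 (b - 1) / (1 + b))" .
    have p': "0 < p" "p \<le> 1" "0 \<le> p" and "1 \<le> n - 1" "1 \<le> b" "0 < b"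
      using assms p False by auto
    with throughput_gap[OF p'(1,2) \<open>1 < b\<close> _ e small]
      r_csi_le[OF \<open>i < n\<close> _ N(1,2) p'(1,2), of b] r_no_ge[OF \<open>i < n\<close> _ N(1,2) p'(3,2), of b]
    show ?thesis unfolding e_def by fastforce
  qed
  ultimately show ?thesis by blast
qed

end
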